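(* Let $G$ be a group of order $2^m$ of rank $5$ belonging to the isoclinism family $\Gamma_8$. Then (1) $\displaystyle A_G(t/|G|)=\frac{1-2^{-1}}{1-2^{-3}t} + \frac{2^{-1}-2^{-4}}{1-2^{-1}t} + \frac{2^{-4}}{1-t}$; (2) $\displaystyle B_G(t/|G|)=\frac{-2^{-1}}{1-2^{-4}t} + \frac{1}{1-2^{-3}t} + \frac{2^{-1}}{1-2^{-1}t}$.
   Context: For a finite group $G$ and $n\ge 0$, $\alpha_{G,n}$ denotes the number of orbits of $G$ acting on $G^n$ by simultaneous conjugation $g\cdot(x_1,\dots,x_n)=(gx_1g^{-1},\dots,gx_ng^{-1})$, and $\beta_{G,n}$ denotes the number of orbits of the same action on the set $G^{(n)}$ of $n$-tuples of pairwise commuting elements of $G$; $\alpha_{G,0}=\beta_{G,0}=1$. Set $A_G(t)=\sum_{n\ge 0}\alpha_{G,n}t^n$ and $B_G(t)=\sum_{n\ge 0}\beta_{G,n}t^n$ (formal power series, which are rational functions of $t$). $A_G(t/|G|)$, $B_G(t/|G|)$ denote the result of substituting $t/|G|$ for $t$. Finite groups $G,H$ are isoclinic if there are isomorphisms $\theta:G/Z(G)\to H/Z(H)$ and $\phi:G'\to H'$ (derived subgroups) such that $\phi([g_1,g_2])=[h_1,h_2]$ whenever $\theta(g_iZ(G))=h_iZ(H)$ for $i=1,2$. Isoclinism is an equivalence relation, whose classes are called isoclinism families. For a finite $2$-group $G$, the rank of (the family of) $G$ is the smallest $r$ such that the isoclinism family of $G$ contains a group of order $2^r$. $\Gamma_8$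 (Hall–Senior notation) is the isoclinism family, of rank 5, of the dihedral group $\Gamma_8a_1$ of order $32$. $G$ belongs to $\Gamma_8$ if $G$ is a finite $2$-group isoclinic to the dihedral group of order $32$. *)

theory Defs
  imports
    "HOL-Computational_Algebra.Formal_Power_Series"
    "HOL-Algebra.Generated_Groups"
    "HOL-Algebra.Group_Action"
begin

subsection \<open>Simultaneous conjugation on tuples\<close>

definition tuples :: "('a, 'b) monoid_scheme \<Rightarrow> nat \<Rightarrow> 'a list set" where
  "tuples G n = {xs. length xs = n \<and> set xs \<subseteq> carrier G}"

definition commuting_tuples :: "('a, 'b) monoid_scheme \<Rightarrow> nat \<Rightarrow> 'a list set" where
  "commuting_tuples G n =
     {xs \<in> tuples G n. \<forall>x\<in>set xs. \<forall>y\<in>set xs. x \<otimes>\<^bsub>G\<^esub> y = y \<otimes>\<^bsub>G\<^esub> x}"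

text \<open>The restriction to \<open>E\<close> is there because \<^locale>\<open>group_action\<close> expects extensional maps.\<close>

definition simult_conj :: "('a, 'b) monoid_scheme \<Rightarrow> 'a list set \<Rightarrow> 'a \<Rightarrow> 'a list \<Rightarrow> 'a list" where
  "simult_conj G E g = (\<lambda>xs\<in>E. map (\<lambda>x. g \<otimes>\<^bsub>G\<^esub> x \<otimes>\<^bsub>G\<^esub> inv\<^bsub>G\<^esub> g) xs)"

definition alpha :: "('a, 'b) monoid_scheme \<Rightarrow> nat \<Rightarrow> nat" where
  "alpha G n = card (orbits G (tuples G n) (simult_conj G (tuples G n)))"

definition beta :: "('a, 'b) monoid_scheme \<Rightarrow> nat \<Rightarrow> nat" where
  "beta G n = card (orbits G (commuting_tuples G n) (simult_conj G (commuting_tuples G n)))"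

definition A_series :: "('a, 'b) monoid_scheme \<Rightarrow> rat fps" where
  "A_series G = Abs_fps (\<lambda>n. of_nat (alpha G n))"

definition B_series :: "('a, 'b) monoid_scheme \<Rightarrow> rat fps" where
  "B_series G = Abs_fps (\<lambda>n. of_nat (beta G n))"


subsection \<open>Isoclinism\<close>

definition center :: "('a, 'b) monoid_scheme \<Rightarrow> 'a set" where
  "center G = {z \<in> carrier G. \<forall>g\<in>carrier G. z \<otimes>\<^bsub>G\<^esub> g = g \<otimes>\<^bsub>G\<^esub> z}"

text \<open>
  The convention \<open>[x, y] = x y x\<inverse> y\<inverse>\<close> is the one used by \<^const>\<open>derived\<close>.  The other common
  convention \<open>x\<inverse> y\<inverse> x y\<close> gives the same isoclinism relation.
\<close>

definition commutator :: "('a, 'b) monoid_scheme \<Rightarrow> 'a \<Rightarrow> 'a \<Rightarrow> 'a" where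
  "commutator G x y = x \<otimes>\<^bsub>G\<^esub> y \<otimes>\<^bsub>G\<^esub> inv\<^bsub>G\<^esub> x \<otimes>\<^bsub>G\<^esub> inv\<^bsub>G\<^esub> y"

abbreviation derived_subgroup :: "('a, 'b) monoid_scheme \<Rightarrow> ('a, 'b) monoid_scheme" where
  "derived_subgroup G \<equiv> G\<lparr>carrier := derived G (carrier G)\<rparr>"

definition isoclinic :: "('a, 'b) monoid_scheme \<Rightarrow> ('c, 'd) monoid_scheme \<Rightarrow> bool" where
  "isoclinic G H \<longleftrightarrow>
     (\<exists>\<theta> \<phi>. \<theta> \<in> iso (G Mod center G) (H Mod center H) \<and>
            \<phi> \<in> iso (derived_subgroup G) (derived_subgroup H) \<and>
            (\<forall>g1\<in>carrier G. \<forall>g2\<in>carrier G. \<forall>h1\<in>carrier H. \<forall>h2\<in>carrier H.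
               \<theta> (center G #>\<^bsub>G\<^esub> g1) = center H #>\<^bsub>H\<^esub> h1 \<longrightarrow>
               \<theta> (center G #>\<^bsub>G\<^esub> g2) = center H #>\<^bsub>H\<^esub> h2 \<longrightarrow>
               \<phi> (commutator G g1 g2) = commutator H h1 h2))"

text \<open>
  A HOL formula cannot quantify over the carrier types of all groups in the isoclinism family
  of \<open>G\<close>.  Every finite group is isomorphic to one with carrier in \<^typ>\<open>nat\<close>, so it is enough
  to let \<open>H\<close> range over those.
\<close>

definition isoclinism_rank :: "('a, 'b) monoid_scheme \<Rightarrow> nat" where
  "isoclinism_rank G = (LEAST r. \<exists>H :: nat monoid. group H \<and> Coset.order H = 2 ^ r \<and> isoclinic G H)"


subsection \<open>The family of the dihedral group of order 32\<close>

text \<open>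
  The dihedral group of order \<open>2 * n\<close>: the pair \<open>(k, e)\<close> stands for \<open>r\<^sup>k s\<^sup>e\<close>, where \<open>r\<close> is a
  rotation of order \<open>n\<close> and \<open>s\<close> a reflection with \<open>s r s = r\<inverse>\<close>.
\<close>

definition dihedral_group :: "nat \<Rightarrow> (int \<times> bool) monoid" where
  "dihedral_group n =
     \<lparr>carrier = {0..<int n} \<times> UNIV,
      monoid.mult = (\<lambda>(k, e) (l, f). ((if e then k - l else k + l) mod int n, e \<noteq> f)),
      one = (0, False)\<rparr>"

lemma order_dihedral_group: "Coset.order (dihedral_group n) = 2 * n"
  by (simp add: Coset.order_def dihedral_group_def card_cartesian_product)

lemma group_dihedral_group:
  assumes "n > 0"
  shows "group (dihedral_group n)"
proof (rule groupI)
  fix x y z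
  assume "x \<in> carrier (dihedral_group n)" "y \<in> carrier (dihedral_group n)"
    "z \<in> carrier (dihedral_group n)"
  then show "x \<otimes>\<^bsub>dihedral_group n\<^esub> y \<otimes>\<^bsub>dihedral_group n\<^esub> z =
    x \<otimes>\<^bsub>dihedral_group n\<^esub> (y \<otimes>\<^bsub>dihedral_group n\<^esub> z)"
    by (auto simp: dihedral_group_def mod_simps algebra_simps)
next
  fix x
  assume x: "x \<in> carrier (dihedral_group n)"
  obtain k e where ke: "x = (k, e)" by (cases x)
  let ?y = "(if e then k else (- k) mod int n, e)"
  have "?y \<in> carrier (dihedral_group n)"
    using x ke assms by (auto simp: dihedral_group_def)
  moreover have "?y \<otimes>\<^bsub>dihedral_group n\<^esub> x = \<one>\<^bsub>dihedral_group n\<^esub>"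
    by (auto simp: dihedral_group_def ke mod_simps)
  ultimately show "\<exists>y\<in>carrier (dihedral_group n). y \<otimes>\<^bsub>dihedral_group n\<^esub> x = \<one>\<^bsub>dihedral_group n\<^esub>"
    by blast
qed (use assms in \<open>auto simp: dihedral_group_def\<close>)

definition in_Gamma8 :: "('a, 'b) monoid_scheme \<Rightarrow> bool" where
  "in_Gamma8 G \<longleftrightarrow> group G \<and> (\<exists>k. Coset.order G = 2 ^ k) \<and> isoclinic G (dihedral_group 16)"

end

theory Submission
  imports Defs
begin

text \<open>
  By Burnside's lemma, \<open>\<alpha>\<^sub>n |G|\<close> is the sum of \<open>|C(g)|\<^sup>n\<close> over \<open>g \<in> G\<close> and \<open>\<beta>\<^sub>n |G|\<close> is the number of
  commuting \<open>(n + 1)\<close>-tuples.  Both depend only on the relation of commuting, and an isoclinism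
  transports that relation along maps all of whose fibres over cosets of the centre have the same
  size.  So it suffices to know the dihedral group of order 32: there, noncentral elements commute
  exactly if they lie in the same one of nine classes, namely the 14 noncentral rotations and eight
  pairs of reflections.
\<close>

text \<open>Substituting \<open>a * X\<close> into the geometric series gives the inverse of
  \<open>1 - a * X\<close>. The claimed rational functions are sums of such terms, so they can be
  compared coefficientwise.\<close>

lemma fps_geometric_nth:
  fixes a c :: "'a::field"
  shows "fps_nth (fps_const c / (1 - fps_const a * fps_X)) n = c * a ^ n"
proof -
  have "1 / (1 - fps_const a * fps_X) = Abs_fps (\<lambda>n. a ^ n)"
    using gp[of "fps_const a * fps_X"] by (simp add: fps_compose_linear)
  then show ?thesis
    by (simp add: fps_divide_unit)
qed

subsection \<open>Counting orbits of tuples\<close>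

text \<open>These are the fixed points of \<open>g\<close> under simultaneous conjugation, phrased
  through commuting because that relation is all that an isoclinism transports.\<close>

definition fixed_by :: "('a, 'b) monoid_scheme \<Rightarrow> 'a list set \<Rightarrow> 'a \<Rightarrow> 'a list set" where
  "fixed_by G E g = {xs \<in> E. \<forall>x\<in>set xs. g \<otimes>\<^bsub>G\<^esub> x = x \<otimes>\<^bsub>G\<^esub> g}"

context group
begin

lemma conj_mult:
  assumes "g \<in> carrier G" "h \<in> carrier G" "x \<in> carrier G"
  shows "g \<otimes> h \<otimes> x \<otimes> inv (g \<otimes> h) = g \<otimes> (h \<otimes> x \<otimes> inv h) \<otimes> inv g"
  using assms by (simp add: inv_mult_group m_assoc)

lemma conj_eq_iff:
  assumes "g \<in> carrier G" "x \<in> carrier G"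
  shows "g \<otimes> x \<otimes> inv g = x \<longleftrightarrow> g \<otimes> x = x \<otimes> g"
  using assms by (simp add: inv_solve_right')

lemma commuting_conj:
  assumes "g \<in> carrier G" "x \<in> carrier G" "y \<in> carrier G" "x \<otimes> y = y \<otimes> x"
  shows "(g \<otimes> x \<otimes> inv g) \<otimes> (g \<otimes> y \<otimes> inv g) = (g \<otimes> y \<otimes> inv g) \<otimes> (g \<otimes> x \<otimes> inv g)"
proof -
  have "(g \<otimes> u \<otimes> inv g) \<otimes> (g \<otimes> v \<otimes> inv g) = g \<otimes> (u \<otimes> v) \<otimes> inv g"
    if "u \<in> carrier G" "v \<in> carrier G" for u v
  proof -
    have "inv g \<otimes> (g \<otimes> (v \<otimes> inv g)) = v \<otimes> inv g"
      using assms(1) that by (simp flip: m_assoc)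
    then show ?thesis
      using assms(1) that by (simp add: m_assoc)
  qed
  then show ?thesis
    using assms by simp
qed

text \<open>Any conjugation-stable set \<open>E\<close> of tuples is allowed, so that all tuples and
  commuting tuples are treated together.\<close>

lemma simult_conj_action:
  assumes E: "E \<subseteq> lists (carrier G)"
    and closed: "\<And>g xs. g \<in> carrier G \<Longrightarrow> xs \<in> E \<Longrightarrow> map (\<lambda>x. g \<otimes> x \<otimes> inv g) xs \<in> E"
  shows "group_action G E (simult_conj G E)"
proof -
  define K where "K g = map (\<lambda>x. g \<otimes> x \<otimes> inv g)" for g
  have K: "simult_conj G E g = restrict (K g) E" for g
    by (simp add: simult_conj_def K_def)
  have K_closed: "K g xs \<in> E" if "g \<in> carrier G" "xs \<in> E" for g xs
    using closed that by (simp add: K_def)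
  have K_mult: "K (g \<otimes> h) xs = K g (K h xs)"
    if "g \<in> carrier G" "h \<in> carrier G" "xs \<in> E" for g h xs
    using that E conj_mult by (auto simp: K_def)
  have K_one: "K \<one> xs = xs" if "xs \<in> E" for xs
    using that E by (auto simp: K_def intro!: map_idI)
  have Bij: "simult_conj G E g \<in> Bij E" if "g \<in> carrier G" for g
  proof -
    have "bij_betw (simult_conj G E g) E E"
      by (rule bij_betw_byWitness[where f' = "simult_conj G E (inv g)"])
        (use that K_closed K_one in \<open>auto simp: K simp flip: K_mult\<close>)
    then show ?thesis
      by (simp add: Bij_def K)
  qed
  have "simult_conj G E (g \<otimes> h) = compose E (simult_conj G E g) (simult_conj G E h)"
    if "g \<in> carrier G" "h \<in> carrier G" for g h
    using that K_closed K_mult by (auto simp: K compose_def fun_eq_iff)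
  then have "simult_conj G E \<in> hom G (BijGroup E)"
    using Bij by (auto simp: hom_def BijGroup_def)
  then show ?thesis
    by (simp add: group_action_def group_hom_def group_hom_axioms_def group_BijGroup is_group)
qed

lemma invariants_simult_conj:
  assumes "E \<subseteq> lists (carrier G)" "g \<in> carrier G"
  shows "invariants E (simult_conj G E) g = fixed_by G E g"
proof -
  have "map (\<lambda>x. g \<otimes> x \<otimes> inv g) xs = xs \<longleftrightarrow> (\<forall>x\<in>set xs. g \<otimes> x = x \<otimes> g)"
    if "xs \<in> E" for xs
  proof -
    have "map (\<lambda>x. g \<otimes> x \<otimes> inv g) xs = xs \<longleftrightarrow> (\<forall>x\<in>set xs. g \<otimes> x \<otimes> inv g = x)"
      using map_eq_conv[of _ xs "\<lambda>x. x"] by simp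
    then show ?thesis
      using assms that conj_eq_iff by blast
  qed
  then show ?thesis
    by (auto simp: invariants_def simult_conj_def fixed_by_def)
qed

lemma tuples_eq: "tuples G n = {xs. set xs \<subseteq> carrier G \<and> length xs = n}"
  by (auto simp: tuples_def)

lemma finite_commuting_tuples: "finite (carrier G) \<Longrightarrow> finite (commuting_tuples G n)"
  by (rule finite_subset[of _ "tuples G n"])
    (auto simp: commuting_tuples_def tuples_eq finite_lists_length_eq)

text \<open>The first entry of a commuting tuple can be any \<open>g\<close>; the remaining entries
  then form a commuting tuple fixed by \<open>g\<close>. The right-hand side is thus the Burnside
  sum for \<open>beta G n\<close>.\<close>

lemma card_commuting_tuples_Suc:
  assumes "finite (carrier G)"
  shows "card (commuting_tuples G (Suc n)) = (\<Sum>g\<in>carrier G. card (fixed_by G (commuting_tuples G n) g))"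
proof -
  have fin: "finite (fixed_by G (commuting_tuples G n) g)" for g
    by (simp add: fixed_by_def finite_commuting_tuples assms)
  have Cons: "g # xs \<in> commuting_tuples G (Suc n) \<longleftrightarrow>
      g \<in> carrier G \<and> xs \<in> fixed_by G (commuting_tuples G n) g" for g xs
  proof -
    \<comment> \<open>Once commuting is an abstract relation, its reflexivity and symmetry suffice
      to split off the first entry.\<close>
    define C where "C x y \<longleftrightarrow> x \<otimes> y = y \<otimes> x" for x y
    have "C x x" "C x y \<longleftrightarrow> C y x" for x y
      by (auto simp: C_def)
    moreover have "length (g # xs) = Suc n \<longleftrightarrow> length xs = n"
      by simp
    ultimately show ?thesis
      unfolding commuting_tuples_def tuples_def fixed_by_def mem_Collect_eq list.set
        C_def[symmetric] by blast
  qed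
  have "commuting_tuples G (Suc n) =
      (\<lambda>(g, xs). g # xs) ` (SIGMA g:carrier G. fixed_by G (commuting_tuples G n) g)"
    (is "?L = ?f ` ?S")
  proof (intro equalityI subsetI)
    fix ys assume "ys \<in> ?L"
    moreover have "length ys = Suc n"
      using \<open>ys \<in> ?L\<close> unfolding commuting_tuples_def tuples_def by blast
    then obtain g xs where "ys = g # xs"
      by (auto simp: length_Suc_conv)
    ultimately show "ys \<in> ?f ` ?S"
      by (auto simp: Cons)
  qed (auto simp: Cons)
  moreover have "inj_on ?f ?S"
    by (auto simp: inj_on_def)
  ultimately have "card ?L = card ?S"
    by (simp add: card_image)
  then show ?thesis
    using assms fin by (simp add: card_SigmaI)
qed

text \<open>Burnside's lemma: the tuples fixed by \<open>g\<close> are exactly those with all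
  entries in the centralizer of \<open>g\<close>.\<close>

lemma alpha_mult_order:
  assumes "finite (carrier G)"
  shows "alpha G n * order G = (\<Sum>g\<in>carrier G. card {x \<in> carrier G. g \<otimes> x = x \<otimes> g} ^ n)"
proof -
  have E: "tuples G n \<subseteq> lists (carrier G)"
    by (auto simp: tuples_def)
  interpret group_action G "tuples G n" "simult_conj G (tuples G n)"
    by (rule simult_conj_action[OF E]) (auto simp: tuples_def)
  have "fixed_by G (tuples G n) g =
      {xs. set xs \<subseteq> {x \<in> carrier G. g \<otimes> x = x \<otimes> g} \<and> length xs = n}" for g
    by (auto simp: fixed_by_def tuples_def)
  then have "card (fixed_by G (tuples G n) g) = card {x \<in> carrier G. g \<otimes> x = x \<otimes> g} ^ n" for g
    using assms by (simp add: card_lists_length_eq)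
  moreover have "alpha G n * order G = (\<Sum>g\<in>carrier G. card (fixed_by G (tuples G n) g))"
    using burnside[OF assms] assms
    by (simp add: alpha_def tuples_eq finite_lists_length_eq invariants_simult_conj E[unfolded tuples_eq])
  ultimately show ?thesis
    by simp
qed

lemma beta_mult_order:
  assumes "finite (carrier G)"
  shows "beta G n * order G = card (commuting_tuples G (Suc n))"
proof -
  have E: "commuting_tuples G n \<subseteq> lists (carrier G)"
    by (auto simp: tuples_def commuting_tuples_def)
  interpret group_action G "commuting_tuples G n" "simult_conj G (commuting_tuples G n)"
  proof (rule simult_conj_action[OF E])
    fix g xs assume g: "g \<in> carrier G" and xs: "xs \<in> commuting_tuples G n"
    have "set xs \<subseteq> carrier G"
      using xs E by auto
    then show "map (\<lambda>x. g \<otimes> x \<otimes> inv g) xs \<in> commuting_tuples G n"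
      using g xs commuting_conj[OF g]
      by (auto simp: commuting_tuples_def tuples_def subset_iff)
  qed
  show ?thesis
    using burnside[OF assms finite_commuting_tuples[OF assms]]
    by (simp add: beta_def card_commuting_tuples_Suc[OF assms] invariants_simult_conj[OF E])
qed

end

subsection \<open>Groups in which commuting is transitive on noncentral elements\<close>

text \<open>
  Commuting is transitive on the noncentral elements exactly if such a labelling exists: label the
  central elements by \<^term>\<open>None\<close> and the others by their centralizers.
\<close>

locale commuting_labelling = group G for G (structure) +
  fixes p :: "'a \<Rightarrow> 'i option" and I :: "'i set"
  assumes finite_carrier: "finite (carrier G)" and finite_labels: "finite I"
    and label: "x \<in> carrier G \<Longrightarrow> p x \<in> insert None (Some ` I)"
    and commute_iff: "x \<in> carrier G \<Longrightarrow> y \<in> carrier G \<Longrightarrow>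
      x \<otimes> y = y \<otimes> x \<longleftrightarrow> p x = None \<or> p y = None \<or> p x = p y"
begin

definition fibre :: "'i option \<Rightarrow> 'a set" where
  "fibre v = {x \<in> carrier G. p x = v}"

lemma finite_fibre: "finite (fibre v)"
  by (simp add: fibre_def finite_carrier)

lemma card_fibre_Un: "card (fibre None \<union> fibre (Some i)) = card (fibre None) + card (fibre (Some i))"
  by (rule card_Un_disjoint) (auto simp: finite_fibre, auto simp: fibre_def)

text \<open>The centralizer of a central element is the whole group, and that of an element labelled
  \<open>Some i\<close> is the centre together with the fibre of \<open>Some i\<close>. Centralizer
  orders are therefore constant on fibres, and the Burnside sum is grouped by label.\<close>

lemma alpha_eq:
  "alpha G n * order G = card (fibre None) * order G ^ n
    + (\<Sum>i\<in>I. card (fibre (Some i)) * (card (fibre None) + card (fibre (Some i))) ^ n)"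
proof -
  define h where "h v = (case v of None \<Rightarrow> order G
    | Some i \<Rightarrow> card (fibre None) + card (fibre (Some i))) ^ n" for v
  have h: "card {x \<in> carrier G. g \<otimes> x = x \<otimes> g} ^ n = h (p g)" if "g \<in> carrier G" for g
  proof (cases "p g")
    case None
    then have "{x \<in> carrier G. g \<otimes> x = x \<otimes> g} = carrier G"
      using that commute_iff by blast
    then show ?thesis
      using None by (simp add: h_def order_def)
  next
    case (Some i)
    then have "{x \<in> carrier G. g \<otimes> x = x \<otimes> g} = fibre None \<union> fibre (Some i)"
      using that commute_iff by (auto simp: fibre_def)
    then show ?thesis
      using Some by (simp add: h_def card_fibre_Un)
  qed
  have "alpha G n * order G = (\<Sum>g\<in>carrier G. h (p g))"
    using h by (simp add: alpha_mult_order finite_carrier)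
  also have "\<dots> = (\<Sum>v\<in>insert None (Some ` I). card (fibre v) * h v)"
    unfolding fibre_def
    by (subst sum_fun_comp[where R = "insert None (Some ` I)"])
      (use finite_carrier finite_labels label in auto)
  also have "\<dots> = card (fibre None) * h None + (\<Sum>i\<in>I. card (fibre (Some i)) * h (Some i))"
    by (subst sum.insert) (auto simp: finite_labels sum.reindex)
  finally show ?thesis
    by (simp add: h_def)
qed

text \<open>A commuting tuple is either entirely central or has a noncentral entry, whose label
  \<open>Some i\<close> is then shared by all its noncentral entries.\<close>

lemma card_commuting_tuples:
  assumes "n > 0"
  shows "card (commuting_tuples G n) = card (fibre None) ^ n
    + (\<Sum>i\<in>I. (card (fibre None) + card (fibre (Some i))) ^ n - card (fibre None) ^ n)"
proof -
  define T where "T S = {xs. set xs \<subseteq> S \<and> length xs = n}" for S :: "'a set"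
  define Z where "Z = fibre None"
  \<comment> \<open>Removing the central tuples leaves those with an entry labelled
    \<open>Some i\<close>, which makes these sets pairwise disjoint.\<close>
  define U where "U i = T (Z \<union> fibre (Some i)) - T Z" for i
  have fin: "finite (T S)" if "finite S" for S
    using that by (simp add: T_def finite_lists_length_eq)
  have card_T: "card (T S) = card S ^ n" if "finite S" for S
    using that by (simp add: T_def card_lists_length_eq)
  have sub: "T Z \<subseteq> T (Z \<union> fibre (Some i))" for i
    by (auto simp: T_def)
  have U: "xs \<in> U i \<longleftrightarrow> set xs \<subseteq> carrier G \<and> length xs = n \<and> (\<forall>x\<in>set xs. p x = None \<or> p x = Some i) \<and>
      (\<exists>x\<in>set xs. p x = Some i)" for xs i
    by (auto simp: U_def T_def Z_def fibre_def)
  have "commuting_tuples G n = T Z \<union> (\<Union>i\<in>I. U i)"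
  proof (intro equalityI subsetI)
    fix xs assume xs: "xs \<in> commuting_tuples G n"
    then have car: "set xs \<subseteq> carrier G" and len: "length xs = n"
      by (auto simp: commuting_tuples_def tuples_def)
    show "xs \<in> T Z \<union> (\<Union>i\<in>I. U i)"
    proof (cases "\<forall>x\<in>set xs. p x = None")
      case True
      then show ?thesis
        using car len by (auto simp: T_def Z_def fibre_def)
    next
      case False
      then obtain x where x: "x \<in> set xs" "p x \<noteq> None"
        by blast
      then have "p x \<in> insert None (Some ` I)"
        using label car by blast
      with x obtain i where i: "p x = Some i" "i \<in> I"
        by auto
      have "p y = None \<or> p y = Some i" if "y \<in> set xs" for y
      proof -
        have "x \<otimes> y = y \<otimes> x"
          using xs x that by (auto simp: commuting_tuples_def)
        then show ?thesis
          using commute_iff car x that i by (metis option.distinct(1) subsetD)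
      qed
      then have "xs \<in> U i"
        using car len x i unfolding U by blast
      then show ?thesis
        using i by blast
    qed
  next
    fix xs assume "xs \<in> T Z \<union> (\<Union>i\<in>I. U i)"
    \<comment> \<open>For a tuple from \<open>U i\<close> the value \<open>v\<close> is
      \<open>Some i\<close>; for a central tuple any value works.\<close>
    then obtain v where car: "set xs \<subseteq> carrier G" and len: "length xs = n"
      and v: "\<forall>x\<in>set xs. p x = None \<or> p x = v"
      by (auto simp: U) (auto simp: T_def Z_def fibre_def)
    have "x \<otimes> y = y \<otimes> x" if "x \<in> set xs" "y \<in> set xs" for x y
    proof -
      have "p x = None \<or> p y = None \<or> p x = p y"
        using v that by metis
      then show ?thesis
        using commute_iff car that by blast
    qed
    then show "xs \<in> commuting_tuples G n"
      using car len by (simp add: commuting_tuples_def tuples_def)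
  qed
  also have "card \<dots> = card (T Z) + card (\<Union>i\<in>I. U i)"
    by (rule card_Un_disjoint) (auto simp: fin finite_fibre finite_labels Z_def U_def)
  also have "card (\<Union>i\<in>I. U i) = (\<Sum>i\<in>I. card (U i))"
    by (rule card_UN_disjoint)
      (auto simp: U finite_labels, auto simp: U_def Z_def fin finite_fibre)
  also have "\<dots> = (\<Sum>i\<in>I. (card Z + card (fibre (Some i))) ^ n - card Z ^ n)"
    using sub by (simp add: U_def card_Diff_subset fin card_T finite_fibre card_fibre_Un Z_def)
  also have "card (T Z) = card Z ^ n"
    by (simp add: card_T Z_def finite_fibre)
  finally show ?thesis
    by (simp add: Z_def)
qed

end

subsection \<open>Transport along an isoclinism\<close>

lemma (in group) center_subgroup: "subgroup (center G) G"
proof (rule subgroupI)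
  show "inv z \<in> center G" if "z \<in> center G" for z
  proof -
    have z: "z \<in> carrier G" "\<And>g. g \<in> carrier G \<Longrightarrow> z \<otimes> g = g \<otimes> z"
      using that by (auto simp: center_def)
    then have "inv z \<otimes> g = g \<otimes> inv z" if "g \<in> carrier G" for g
      using that by (metis inv_closed inv_solve_left inv_solve_right m_assoc m_closed)
    then show ?thesis
      using z by (simp add: center_def)
  qed
  show "y \<otimes> z \<in> center G" if "y \<in> center G" "z \<in> center G" for y z
  proof -
    have y: "y \<in> carrier G" "\<And>g. g \<in> carrier G \<Longrightarrow> y \<otimes> g = g \<otimes> y"
      and z: "z \<in> carrier G" "\<And>g. g \<in> carrier G \<Longrightarrow> z \<otimes> g = g \<otimes> z"
      using that unfolding center_def by blast+
    have "y \<otimes> z \<otimes> g = g \<otimes> (y \<otimes> z)" if "g \<in> carrier G" for g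
      using y z that by (metis m_assoc)
    then show ?thesis
      using y(1) z(1) by (simp add: center_def)
  qed
qed (auto simp: center_def)

text \<open>Lagrange's argument on a part \<open>X\<close> of the group that is a union of cosets.
  It turns counts of cosets of the centre into counts of elements.\<close>

lemma (in group) card_union_of_cosets:
  assumes "subgroup H G" "finite (carrier G)" "X \<subseteq> carrier G"
    and "\<And>x. x \<in> X \<Longrightarrow> H #> x \<subseteq> X"
  shows "card H * card ((#>) H ` X) = card X"
proof -
  have X: "\<Union>((#>) H ` X) = X"
    using assms rcos_self by blast
  have cosets: "(#>) H ` X \<subseteq> rcosets H"
    using assms by (auto simp: RCOSETS_def)
  have "card H * card ((#>) H ` X) = card (\<Union>((#>) H ` X))"
  proof (rule card_partition)
    show "finite ((#>) H ` X)" "finite (\<Union>((#>) H ` X))"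
      unfolding X using assms by (auto intro: finite_subset)
    show "card C = card H" if "C \<in> (#>) H ` X" for C
      using that cosets assms(1) card_rcosets_equal subgroup.subset by (metis subsetD)
    show "C \<inter> D = {}" if "C \<in> (#>) H ` X" "D \<in> (#>) H ` X" "C \<noteq> D" for C D
      using that cosets rcos_disjoint[OF assms(1)] unfolding pairwise_def disjnt_def by blast
  qed
  then show ?thesis
    unfolding X .
qed

lemma (in group) commutator_eq_one_iff:
  assumes "x \<in> carrier G" "y \<in> carrier G"
  shows "commutator G x y = \<one> \<longleftrightarrow> x \<otimes> y = y \<otimes> x"
proof -
  have "commutator G x y = (x \<otimes> y) \<otimes> inv (y \<otimes> x)"
    using assms by (simp add: commutator_def inv_mult_group m_assoc)
  then show ?thesis
    using assms by (simp add: inv_solve_right')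
qed

text \<open>The map \<open>\<phi>\<close> of an isoclinism is injective on the derived subgroup, so
  cancelling it from commutators requires this membership.\<close>

lemma (in group) commutator_in_derived:
  assumes "x \<in> carrier G" "y \<in> carrier G"
  shows "commutator G x y \<in> derived G (carrier G)"
  using assms by (auto simp: derived_def commutator_def intro!: generate.incl)

text \<open>Let \<open>c x\<close> be any representative of the coset assigned by
  \<open>\<theta>\<close> to the coset of \<open>x\<close>. Since \<open>\<phi>\<close> matches
  commutators injectively, \<open>c\<close> preserves and reflects commuting. Since
  \<open>\<theta>\<close> is a bijection of cosets, the preimage under \<open>c\<close> of a union
  of central cosets consists of equally many central cosets.\<close>

lemma isoclinic_transversal:
  assumes "group G" "group H" "finite (carrier G)" "finite (carrier H)" "isoclinic G H"
  obtains c where "c \<in> carrier G \<rightarrow> carrier H"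
    and "\<And>x y. x \<in> carrier G \<Longrightarrow> y \<in> carrier G \<Longrightarrow>
      x \<otimes>\<^bsub>G\<^esub> y = y \<otimes>\<^bsub>G\<^esub> x \<longleftrightarrow> c x \<otimes>\<^bsub>H\<^esub> c y = c y \<otimes>\<^bsub>H\<^esub> c x"
    and "\<And>S. S \<subseteq> carrier H \<Longrightarrow> (\<And>h. h \<in> S \<Longrightarrow> center H #>\<^bsub>H\<^esub> h \<subseteq> S) \<Longrightarrow>
      card (center H) * card {x \<in> carrier G. c x \<in> S} = card (center G) * card S"
proof -
  interpret G: group G by fact
  interpret H: group H by fact
  let ?q = "\<lambda>x. center G #>\<^bsub>G\<^esub> x" and ?r = "\<lambda>h. center H #>\<^bsub>H\<^esub> h"
  obtain \<theta> \<phi> where \<theta>: "bij_betw \<theta> (?q ` carrier G) (?r ` carrier H)"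
    and \<phi>: "inj_on \<phi> (derived G (carrier G))"
    and comm: "\<And>g1 g2 h1 h2. g1 \<in> carrier G \<Longrightarrow> g2 \<in> carrier G \<Longrightarrow> h1 \<in> carrier H \<Longrightarrow>
      h2 \<in> carrier H \<Longrightarrow> \<theta> (?q g1) = ?r h1 \<Longrightarrow> \<theta> (?q g2) = ?r h2 \<Longrightarrow>
      \<phi> (commutator G g1 g2) = commutator H h1 h2"
  proof -
    have "carrier (G Mod center G) = ?q ` carrier G" "carrier (H Mod center H) = ?r ` carrier H"
      by (auto simp: FactGroup_def RCOSETS_def)
    then show thesis
      using assms(5) that unfolding isoclinic_def iso_def by (auto simp: bij_betw_def)
  qed
  have "\<exists>h. h \<in> carrier H \<and> \<theta> (?q x) = ?r h" if "x \<in> carrier G" for x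
    using \<theta> that unfolding bij_betw_def by blast
  then obtain c where c: "\<And>x. x \<in> carrier G \<Longrightarrow> c x \<in> carrier H \<and> \<theta> (?q x) = ?r (c x)"
    by metis
  have \<phi>_comm: "\<phi> (commutator G x y) = commutator H (c x) (c y)"
    if "x \<in> carrier G" "y \<in> carrier G" for x y
    using comm c that by blast
  \<comment> \<open>Both units arise as the commutator of an element with itself: of
    \<open>\<one>\<close> in \<open>G\<close>, and of \<open>c \<one>\<close> in
    \<open>H\<close>.\<close>
  have \<phi>_one: "\<phi> \<one>\<^bsub>G\<^esub> = \<one>\<^bsub>H\<^esub>"
    using \<phi>_comm[of "\<one>\<^bsub>G\<^esub>" "\<one>\<^bsub>G\<^esub>"] c[of "\<one>\<^bsub>G\<^esub>"]
    by (metis G.commutator_eq_one_iff G.one_closed H.commutator_eq_one_iff)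
  show thesis
  proof (rule that)
    show "c \<in> carrier G \<rightarrow> carrier H"
      using c by blast
    fix x y assume xy: "x \<in> carrier G" "y \<in> carrier G"
    have "commutator G x y = \<one>\<^bsub>G\<^esub> \<longleftrightarrow> \<phi> (commutator G x y) = \<phi> \<one>\<^bsub>G\<^esub>"
      using inj_on_eq_iff[OF \<phi> G.commutator_in_derived[OF xy]]
        G.commutator_in_derived[OF G.one_closed G.one_closed] G.commutator_eq_one_iff
      by (metis G.one_closed)
    then show "x \<otimes>\<^bsub>G\<^esub> y = y \<otimes>\<^bsub>G\<^esub> x \<longleftrightarrow> c x \<otimes>\<^bsub>H\<^esub> c y = c y \<otimes>\<^bsub>H\<^esub> c x"
      using xy c by (simp add: \<phi>_comm \<phi>_one G.commutator_eq_one_iff H.commutator_eq_one_iff)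
  next
    fix S assume S: "S \<subseteq> carrier H" "\<And>h. h \<in> S \<Longrightarrow> ?r h \<subseteq> S"
    define X where "X = {x \<in> carrier G. c x \<in> S}"
    \<comment> \<open>The representatives \<open>c x\<close> and \<open>h\<close> of one coset may
      differ, but \<open>S\<close> contains the whole coset of \<open>h\<close>.\<close>
    have in_X: "x \<in> X" if x: "x \<in> carrier G" and h: "h \<in> S" "\<theta> (?q x) = ?r h" for x h
    proof -
      have "c x \<in> ?r h"
        using c[OF x] h(2) H.rcos_self[OF _ H.center_subgroup] by metis
      then show ?thesis
        using S(2)[OF h(1)] x by (auto simp: X_def)
    qed
    have "?q x \<subseteq> X" if "x \<in> X" for x
    proof
      fix y assume y: "y \<in> ?q x"
      have x: "x \<in> carrier G" "c x \<in> S"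
        using that by (auto simp: X_def)
      then have "?q x = ?q y"
        using G.repr_independence[OF y] G.center_subgroup by blast
      moreover have "y \<in> carrier G"
        using y x G.r_coset_subset_G[OF subgroup.subset[OF G.center_subgroup]] by blast
      ultimately show "y \<in> X"
        using in_X[of y "c x"] c[of x] x by simp
    qed
    then have card_X: "card (center G) * card (?q ` X) = card X"
      by (intro G.card_union_of_cosets G.center_subgroup assms) (auto simp: X_def)
    have card_S: "card (center H) * card (?r ` S) = card S"
      using S by (intro H.card_union_of_cosets H.center_subgroup assms)
    have "\<theta> ` ?q ` X = ?r ` S"
    proof (intro equalityI subsetI)
      fix C assume "C \<in> \<theta> ` ?q ` X"
      then show "C \<in> ?r ` S"
        using c by (auto simp: X_def)
    next
      fix C assume "C \<in> ?r ` S"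
      then obtain h where h: "h \<in> S" "C = ?r h"
        by blast
      then have "C \<in> ?r ` carrier H"
        using S(1) by blast
      then have "C \<in> \<theta> ` ?q ` carrier G"
        by (simp only: bij_betw_imp_surj_on[OF \<theta>])
      then obtain x where x: "x \<in> carrier G" "\<theta> (?q x) = C"
        by blast
      then show "C \<in> \<theta> ` ?q ` X"
        using in_X[OF x(1) h(1)] h(2) by blast
    qed
    moreover have "inj_on \<theta> (?q ` X)"
      using \<theta> by (rule inj_on_subset[OF bij_betw_imp_inj_on]) (auto simp: X_def)
    ultimately have "card (?q ` X) = card (?r ` S)"
      by (metis card_image)
    then show "card (center H) * card {x \<in> carrier G. c x \<in> S} = card (center G) * card S"
      using card_X card_S by (metis X_def mult.left_commute)
  qed
qed

subsection \<open>The dihedral group of order 32\<close>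

text \<open>
  The label \<^term>\<open>8\<close> stands for the rotation subgroup, and \<^term>\<open>k\<close> with \<^prop>\<open>0 \<le> k \<and> k < 8\<close>
  for the Klein four-group generated by the centre and the reflection \<open>r\<^sup>k s\<close>.
\<close>

definition dihedral_label :: "int \<times> bool \<Rightarrow> int option" where
  "dihedral_label = (\<lambda>(k, e). if e then Some (k mod 8) else if k mod 8 = 0 then None else Some 8)"

text \<open>Reflections with exponents \<open>k\<close> and \<open>l\<close> commute iff 16 divides
  \<open>2 * (k - l)\<close>, and a rotation with exponent \<open>l\<close> commutes with a
  reflection iff 16 divides \<open>2 * l\<close>; halving gives the residues mod 8. Rotations always
  commute.\<close>

lemma dihedral_commute_iff:
  assumes "x \<in> carrier (dihedral_group 16)" "y \<in> carrier (dihedral_group 16)"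
  shows "x \<otimes>\<^bsub>dihedral_group 16\<^esub> y = y \<otimes>\<^bsub>dihedral_group 16\<^esub> x \<longleftrightarrow>
    dihedral_label x = None \<or> dihedral_label y = None \<or> dihedral_label x = dihedral_label y"
proof -
  obtain k e l f where [simp]: "x = (k, e)" "y = (l, f)"
    by (metis surj_pair)
  have double: "16 dvd 2 * d \<longleftrightarrow> 8 dvd d" for d :: int
    by presburger
  have diff: "k - l - (l - k) = 2 * (k - l)" "k - l - (k + l) = 2 * (- l)" "k + l - (l - k) = 2 * k"
    by simp_all
  have both: "(k - l) mod 16 = (l - k) mod 16 \<longleftrightarrow> k mod 8 = l mod 8"
    and rot: "(k - l) mod 16 = (k + l) mod 16 \<longleftrightarrow> l mod 8 = 0"
    and rot': "(k + l) mod 16 = (l - k) mod 16 \<longleftrightarrow> k mod 8 = 0"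
    by (simp_all only: mod_eq_dvd_iff mod_eq_0_iff_dvd diff double dvd_minus_iff)
  \<comment> \<open>The label 8 of the noncentral rotations is never the label of a
    reflection.\<close>
  have less: "j mod 8 \<noteq> 8" for j :: int
    by presburger
  show ?thesis
    by (cases e; cases f)
      (simp_all add: dihedral_group_def dihedral_label_def both rot rot' less less[symmetric] add.commute)
qed

text \<open>For exponents from 0 to 15 the residue mod 8 becomes a case distinction, from which the
  fibres can be listed.\<close>

lemma dihedral_label_eq:
  assumes "(k, e) \<in> carrier (dihedral_group 16)"
  shows "dihedral_label (k, e) = (if e then Some (if k < 8 then k else k - 8)
    else if k = 0 \<or> k = 8 then None else Some 8)"
proof -
  have "k mod 8 = (if k < 8 then k else k - 8)"
    using assms by (auto simp: dihedral_group_def) presburger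
  then show ?thesis
    using assms by (auto simp: dihedral_label_def dihedral_group_def)
qed

lemma dihedral_label_None:
  "{x \<in> carrier (dihedral_group 16). dihedral_label x = None} = {(0, False), (8, False)}"
  by (auto simp: dihedral_label_eq split: if_splits) (auto simp: dihedral_group_def dihedral_label_def)

lemma dihedral_label_rotation:
  "card {x \<in> carrier (dihedral_group 16). dihedral_label x = Some 8} = 14"
proof -
  have "{x \<in> carrier (dihedral_group 16). dihedral_label x = Some 8} =
      ({1..7} \<union> {9..15}) \<times> {False}"
    by (auto simp: dihedral_label_eq split: if_splits)
      (auto simp: dihedral_group_def dihedral_label_def, presburger)
  then show ?thesis
    by (simp add: card_cartesian_product card_Un_disjoint)
qed

lemma dihedral_label_reflection:
  assumes "0 \<le> j" "j < 8"
  shows "card {x \<in> carrier (dihedral_group 16). dihedral_label x = Some j} = 2"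
proof -
  have "{x \<in> carrier (dihedral_group 16). dihedral_label x = Some j} = {(j, True), (j + 8, True)}"
    using assms
    by (auto simp: dihedral_label_eq split: if_splits) (auto simp: dihedral_group_def dihedral_label_def)
  then show ?thesis
    by simp
qed

text \<open>An element commuting with both the rotation \<open>(1, False)\<close> and the reflection
  \<open>(0, True)\<close> has label \<open>None\<close>, since it cannot carry both labels 8 and
  0.\<close>

lemma center_dihedral_group: "center (dihedral_group 16) = {(0, False), (8, False)}"
proof -
  have carr: "(1, False) \<in> carrier (dihedral_group 16)" "(0, True) \<in> carrier (dihedral_group 16)"
    by (auto simp: dihedral_group_def)
  have "dihedral_label (1, False) = Some 8" "dihedral_label (0, True) = Some 0"
    by (simp_all add: dihedral_label_def)
  then have "dihedral_label x = None" if "x \<in> center (dihedral_group 16)" for x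
    using that carr dihedral_commute_iff[of x "(1, False)"] dihedral_commute_iff[of x "(0, True)"]
    by (auto simp: center_def)
  then have "center (dihedral_group 16) =
      {x \<in> carrier (dihedral_group 16). dihedral_label x = None}"
    using dihedral_commute_iff by (auto simp: center_def)
  then show ?thesis
    by (simp add: dihedral_label_None)
qed

text \<open>Multiplication by the central rotation \<open>(8, False)\<close> shifts the exponent by
  8. Hence the fibres of the label are unions of central cosets, as transport along an isoclinism
  requires.\<close>

lemma dihedral_label_coset:
  assumes "x \<in> center (dihedral_group 16) #>\<^bsub>dihedral_group 16\<^esub> h"
    and "h \<in> carrier (dihedral_group 16)"
  shows "x \<in> carrier (dihedral_group 16)" "dihedral_label x = dihedral_label h"
proof -
  obtain k e where h: "h = (k, e)"
    by (metis surj_pair)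
  then have x: "x = (k mod 16, e) \<or> x = ((8 + k) mod 16, e)"
    using assms by (auto simp: r_coset_def center_dihedral_group) (auto simp: dihedral_group_def)
  then show "x \<in> carrier (dihedral_group 16)"
    by (auto simp: dihedral_group_def)
  have "(k mod 16) mod 8 = k mod 8" "((8 + k) mod 16) mod 8 = k mod 8"
    by (simp_all add: mod_mod_cancel)
  then show "dihedral_label x = dihedral_label h"
    using x by (auto simp: h dihedral_label_def)
qed

subsection \<open>The orbit counts in the family\<close>

text \<open>Each element of \<open>G\<close> takes the label of its dihedral representative. The
  dihedral centre has order 2, so the fibre sizes 2, 14 and 2 and the order 32 are all multiplied by
  half of \<open>card (center G)\<close>.\<close>

lemma Gamma8_labelling:
  assumes "in_Gamma8 G"
  obtains p where "commuting_labelling G p {0..8::int}"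
    and "order G = 16 * card (center G)"
    and "card {x \<in> carrier G. p x = None} = card (center G)"
    and "card {x \<in> carrier G. p x = Some 8} = 7 * card (center G)"
    and "\<forall>j\<in>{0..<8}. card {x \<in> carrier G. p x = Some j} = card (center G)"
proof -
  let ?D = "dihedral_group 16"
  interpret group G
    using assms by (simp add: in_Gamma8_def)
  obtain k where "order G = 2 ^ k"
    using assms by (auto simp: in_Gamma8_def)
  \<comment> \<open>An infinite carrier would have order 0, which is no power of 2.\<close>
  then have fin: "finite (carrier G)"
    by (metis order_gt_0_iff_finite zero_less_numeral zero_less_power)
  have D: "group ?D" "finite (carrier ?D)"
    by (simp add: group_dihedral_group) (simp add: dihedral_group_def)
  obtain c where c: "c \<in> carrier G \<rightarrow> carrier ?D"
    and comm: "\<And>x y. x \<in> carrier G \<Longrightarrow> y \<in> carrier G \<Longrightarrow>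
      x \<otimes>\<^bsub>G\<^esub> y = y \<otimes>\<^bsub>G\<^esub> x \<longleftrightarrow> c x \<otimes>\<^bsub>?D\<^esub> c y = c y \<otimes>\<^bsub>?D\<^esub> c x"
    and card_S: "\<And>S. S \<subseteq> carrier ?D \<Longrightarrow> (\<And>h. h \<in> S \<Longrightarrow> center ?D #>\<^bsub>?D\<^esub> h \<subseteq> S) \<Longrightarrow>
      card (center ?D) * card {x \<in> carrier G. c x \<in> S} = card (center G) * card S"
    using isoclinic_transversal[OF is_group D(1) fin D(2)] assms unfolding in_Gamma8_def by blast
  have order: "2 * order G = card (center G) * 32"
  proof -
    have "card (center ?D) * card {x \<in> carrier G. c x \<in> carrier ?D} =
        card (center G) * card (carrier ?D)"
      by (rule card_S) (use dihedral_label_coset(1) in auto)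
    moreover have "{x \<in> carrier G. c x \<in> carrier ?D} = carrier G"
      using c by auto
    moreover have "card (carrier ?D) = 32"
      using order_dihedral_group[of 16] by (simp add: order_def)
    ultimately show ?thesis
      by (simp add: center_dihedral_group order_def)
  qed
  have fibre: "2 * card {x \<in> carrier G. dihedral_label (c x) = v} =
      card (center G) * card {h \<in> carrier ?D. dihedral_label h = v}" for v
  proof -
    have "card (center ?D) * card {x \<in> carrier G. c x \<in> {h \<in> carrier ?D. dihedral_label h = v}} =
        card (center G) * card {h \<in> carrier ?D. dihedral_label h = v}"
      by (rule card_S) (use dihedral_label_coset in auto)
    moreover have "{x \<in> carrier G. c x \<in> {h \<in> carrier ?D. dihedral_label h = v}} =
        {x \<in> carrier G. dihedral_label (c x) = v}"
      using c by auto
    ultimately show ?thesis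
      by (simp add: center_dihedral_group)
  qed
  have label: "dihedral_label h \<in> insert None (Some ` {0..8})" for h
    by (cases h) (auto simp: dihedral_label_def intro!: imageI)
  have "commuting_labelling G (dihedral_label \<circ> c) {0..8}"
  proof
    show "x \<otimes>\<^bsub>G\<^esub> y = y \<otimes>\<^bsub>G\<^esub> x \<longleftrightarrow> (dihedral_label \<circ> c) x = None \<or>
        (dihedral_label \<circ> c) y = None \<or> (dihedral_label \<circ> c) x = (dihedral_label \<circ> c) y"
      if "x \<in> carrier G" "y \<in> carrier G" for x y
      unfolding comm[OF that] comp_def using that c by (intro dihedral_commute_iff) auto
  qed (use fin label in \<open>simp_all add: comp_def\<close>)
  moreover have "card {x \<in> carrier G. (dihedral_label \<circ> c) x = None} = card (center G)"
    using fibre[of None] by (simp add: dihedral_label_None)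
  moreover have "card {x \<in> carrier G. (dihedral_label \<circ> c) x = Some 8} = 7 * card (center G)"
    using fibre[of "Some 8"] by (simp add: dihedral_label_rotation)
  moreover have "\<forall>j\<in>{0..<8}. card {x \<in> carrier G. (dihedral_label \<circ> c) x = Some j} = card (center G)"
  proof
    fix j :: int assume "j \<in> {0..<8}"
    then show "card {x \<in> carrier G. (dihedral_label \<circ> c) x = Some j} = card (center G)"
      using fibre[of "Some j"] by (simp add: dihedral_label_reflection)
  qed
  ultimately show thesis
    using order by (intro that[of "dihedral_label \<circ> c"]) simp_all
qed

text \<open>Noncentral centralizers have order \<open>8 * N\<close> for the \<open>7 * N\<close>
  elements labelled 8, and \<open>2 * N\<close> for the eight fibres of size \<open>N\<close>. The
  negative term of the count for \<open>beta\<close> stands on the left because the equation is over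
  the naturals.\<close>

lemma Gamma8_orbit_counts:
  assumes "in_Gamma8 G"
  defines "N \<equiv> card (center G)"
  shows "order G = 16 * N"
    and "alpha G n * order G = N * order G ^ n + 8 * N * (2 * N) ^ n + 7 * N * (8 * N) ^ n"
    and "beta G n * order G + 8 * N ^ Suc n = 8 * (2 * N) ^ Suc n + (8 * N) ^ Suc n"
proof -
  obtain p where p: "commuting_labelling G p {0..8::int}"
    and order: "order G = 16 * N"
    and central: "card {x \<in> carrier G. p x = None} = N"
    and rotation: "card {x \<in> carrier G. p x = Some 8} = 7 * N"
    and reflection: "\<forall>j\<in>{0..<8}. card {x \<in> carrier G. p x = Some j} = N"
    by (rule Gamma8_labelling[OF assms(1), folded N_def])
  interpret commuting_labelling G p "{0..8::int}"
    by (rule p)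
  have labels: "{0..8::int} = insert 8 {0..<8}"
    by auto
  have sum_labels: "(\<Sum>i\<in>{0..8}. f (card (fibre (Some i)))) = f (7 * N) + 8 * f N"
    for f :: "nat \<Rightarrow> nat"
    unfolding labels by (simp add: fibre_def rotation reflection)
  have fibre_None: "card (fibre None) = N"
    by (simp add: fibre_def central)
  have double: "N + N = 2 * N" and octuple: "N + 7 * N = 8 * N"
    by simp_all
  show "order G = 16 * N"
    by (rule order)
  show "alpha G n * order G = N * order G ^ n + 8 * N * (2 * N) ^ n + 7 * N * (8 * N) ^ n"
    unfolding alpha_eq fibre_None sum_labels[of "\<lambda>k. k * (N + k) ^ n"] double octuple by simp
  have "beta G n * order G =
      N ^ Suc n + (((8 * N) ^ Suc n - N ^ Suc n) + 8 * ((2 * N) ^ Suc n - N ^ Suc n))"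
    unfolding beta_mult_order[OF finite_carrier] card_commuting_tuples[OF zero_less_Suc]
      fibre_None sum_labels[of "\<lambda>k. (N + k) ^ Suc n - N ^ Suc n"] double octuple ..
  \<comment> \<open>These bounds ensure that no subtraction of naturals is truncated.\<close>
  moreover have "N ^ Suc n \<le> (8 * N) ^ Suc n" "N ^ Suc n \<le> (2 * N) ^ Suc n"
    by (rule power_mono; simp)+
  ultimately show "beta G n * order G + 8 * N ^ Suc n = 8 * (2 * N) ^ Suc n + (8 * N) ^ Suc n"
    by linarith
qed

theorem lemma5p18:
  fixes G :: "('a, 'b) monoid_scheme" and m :: nat
  assumes "group G"
    and "Coset.order G = 2 ^ m"
    and "isoclinism_rank G = 5"
    and "in_Gamma8 G"
  shows "(A_series G oo (fps_const (1 / of_nat (Coset.order G)) * fps_X) =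
           fps_const (1 - 1 / 2) / (1 - fps_const (1 / 2 ^ 3) * fps_X)
         + fps_const (1 / 2 - 1 / 2 ^ 4) / (1 - fps_const (1 / 2) * fps_X)
         + fps_const (1 / 2 ^ 4) / (1 - fps_X))
       \<and> (B_series G oo (fps_const (1 / of_nat (Coset.order G)) * fps_X) =
           fps_const (- (1 / 2)) / (1 - fps_const (1 / 2 ^ 4) * fps_X)
         + 1 / (1 - fps_const (1 / 2 ^ 3) * fps_X)
         + fps_const (1 / 2) / (1 - fps_const (1 / 2) * fps_X))"
proof -
  define N where "N = card (center G)"
  note counts = Gamma8_orbit_counts[OF assms(4), folded N_def]
  note order = counts(1)
  have "N > 0"
    using assms(2) order by (cases "N = 0") auto
  then have N: "(of_nat N :: rat) \<noteq> 0"
    by simp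
  \<comment> \<open>Substituting \<open>t / |G|\<close> multiplies the coefficient of index
    \<open>n\<close> by \<open>s n\<close>.\<close>
  define s :: "nat \<Rightarrow> rat" where "s n = (1 / of_nat (order G)) ^ n" for n
  \<comment> \<open>As \<open>|G| = 16 * N\<close>, the unknown \<open>N\<close> cancels: the growth
    rates \<open>16 * N\<close>, \<open>8 * N\<close>, \<open>2 * N\<close> and \<open>N\<close>
    become 1, 1/2, 1/8 and 1/16.\<close>
  have scale: "s n * (c * of_nat N) ^ n = (c / 16) ^ n" for c n
    using N by (simp add: s_def order flip: power_mult_distrib)
  have alpha: "s n * of_nat (alpha G n) =
      1 / 2 * (1 / 8) ^ n + 7 / 16 * (1 / 2) ^ n + 1 / 16" for n
  proof -
    have "of_nat N * (16 * of_nat (alpha G n) :: rat) = of_nat N *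
        ((16 * of_nat N) ^ n + 8 * (2 * of_nat N) ^ n + 7 * (8 * of_nat N) ^ n)"
      using arg_cong[OF counts(2)[of n], of "of_nat :: nat \<Rightarrow> rat"]
      by (simp add: order power_mult_distrib algebra_simps)
    then have "16 * of_nat (alpha G n) =
        (16 * of_nat N :: rat) ^ n + 8 * (2 * of_nat N) ^ n + 7 * (8 * of_nat N) ^ n"
      using N by (simp only: mult_cancel_left) simp
    then have "s n * (16 * of_nat (alpha G n)) =
        s n * (16 * of_nat N) ^ n + 8 * (s n * (2 * of_nat N) ^ n) + 7 * (s n * (8 * of_nat N) ^ n)"
      by (simp only: distrib_left mult.left_commute)
    then show ?thesis
      unfolding scale by simp
  qed
  have beta: "s n * of_nat (beta G n) = - (1 / 2) * (1 / 16) ^ n + (1 / 8) ^ n + 1 / 2 * (1 / 2) ^ n"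
    for n
  proof -
    \<comment> \<open>The factor 1 in \<open>1 * of_nat N\<close> lets \<open>scale\<close> apply
      with \<open>c = 1\<close>.\<close>
    have "of_nat N * (16 * of_nat (beta G n) + 8 * (1 * of_nat N) ^ n :: rat) = of_nat N *
        (16 * (2 * of_nat N) ^ n + 8 * (8 * of_nat N) ^ n)"
      using arg_cong[OF counts(3)[of n], of "of_nat :: nat \<Rightarrow> rat"]
      by (simp add: order power_mult_distrib algebra_simps)
    then have "16 * of_nat (beta G n) + 8 * (1 * of_nat N) ^ n =
        16 * (2 * of_nat N :: rat) ^ n + 8 * (8 * of_nat N) ^ n"
      using N by (simp only: mult_cancel_left) simp
    then have "s n * (16 * of_nat (beta G n)) + 8 * (s n * (1 * of_nat N) ^ n) =
        16 * (s n * (2 * of_nat N) ^ n) + 8 * (s n * (8 * of_nat N) ^ n)"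
      by (simp only: mult.left_commute[of _ "s n"] flip: distrib_left)
    then show ?thesis
      unfolding scale by simp
  qed
  show ?thesis
    unfolding fps_eq_iff fps_compose_linear A_series_def B_series_def
    \<comment> \<open>The two instances cover the denominator \<open>1 - fps_X\<close> and the
      numerator \<open>1\<close>, where the constant 1 is not written with
      \<open>fps_const\<close>.\<close>
    using alpha beta fps_geometric_nth[where a = "1 :: rat"] fps_geometric_nth[where c = "1 :: rat"]
    by (simp add: fps_geometric_nth s_def)
qed

end
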